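(* Let $h(x)=\min_{i\in\{1,\ldots,p\}}h_i(x)$ be a composite barrier on an open set $\mathcal{D}\subseteq\mathbb{R}^n$, evaluated over $\mathbb{R}$ by a straight-line program, and let $C_h$ be the number of elementary arithmetic operations (i.e., additions, multiplications, and comparisons) required to evaluate $h(x)$ over $\mathbb{R}$. Then, for any continuous vector field $v\colon\mathcal{D}\to\mathbb{R}^n$, the dual extension $\tilde h(x_{\mathbb{D},v})$ is evaluated in at most $4C_h$ real operations, an overhead of at most $3C_h$, independent of the state dimension $n$, the constraint count $p$, the active-set cardinality $|\mathcal{A}(x)|$, and the direction $v$.
   Context: Dual numbers: $\mathbb{D}\triangleq\mathbb{R}[\epsilon]/(\epsilon^2)$, elements stored as pairs $(a,b)$ representing $a+b\epsilon$, $\Re(a+b\epsilon)\triangleq a$, with $(a_1+b_1\epsilon)+(a_2+b_2\epsilon)=(a_1+a_2)+(b_1+b_2)\epsilon$ and $(a_1+b_1\epsilon)(a_2+b_2\epsilon)=a_1a_2+(a_1b_2+a_2b_1)\epsilon$. $\min_\Re(z_1,z_2)\triangleq z_1$ if $\Re(z_1)\le\Re(z_2)$, else $z_2$. The dual lift is $x_{\mathbb{D},v}\triangleq x+v(x)\epsilon\in\mathbb{D}^n$ (given as input). The dual extension $\tilde h(x_{\mathbb{D},v})\triangleq\min_\Re(\tilde h_1(x_{\mathbb{D},v}),\ldots,\tilde h_p(x_{\mathbb{D},v}))$ (left-to-right), with $\tilde h_i(x+w\epsilon)=h_i(x)+\nabla h_i(x)w\,\epsilon$, is evaluated by running the straight-line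 program of $h$ over $\mathbb{D}$, replacing every real operation by its dual counterpart (addition and multiplication by those of $\mathbb{D}$, each comparison/minimum by $\min_\Re$). Real operations are counted as real additions, real multiplications, real comparisons, and conditional copies of a two-field record (each counted once). The active set is $\mathcal{A}(x)\triangleq\{i:h_i(x)=h(x)\}$. *)

theory Defs
  imports "HOL-Analysis.Analysis"
begin

datatype dual = Dual (dre: real) (deps: real)

instantiation dual :: comm_ring_1
begin

definition zero_dual :: dual where "0 = Dual 0 0"
definition one_dual :: dual where "1 = Dual 1 0"
definition plus_dual :: "dual \<Rightarrow> dual \<Rightarrow> dual"
  where "z + w = Dual (dre z + dre w) (deps z + deps w)"
definition times_dual :: "dual \<Rightarrow> dual \<Rightarrow> dual"
  where "z * w = Dual (dre z * dre w) (dre z * deps w + dre w * deps z)"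
definition uminus_dual :: "dual \<Rightarrow> dual" where "- z = Dual (- dre z) (- deps z)"
definition minus_dual :: "dual \<Rightarrow> dual \<Rightarrow> dual"
  where "z - w = Dual (dre z - dre w) (deps z - deps w)"

instance
  by standard
    (auto simp: zero_dual_def one_dual_def plus_dual_def times_dual_def uminus_dual_def
      minus_dual_def algebra_simps intro: dual.expand)

end

definition min_re :: "dual \<Rightarrow> dual \<Rightarrow> dual"
  where "min_re z w = (if dre z \<le> dre w then z else w)"

definition dual_lift :: "(real^'n \<Rightarrow> real^'n) \<Rightarrow> real^'n \<Rightarrow> dual^'n"
  where "dual_lift v x = (\<chi> i. Dual (x $ i) (v x $ i))"

definition gradient :: "(real^'n \<Rightarrow> real) \<Rightarrow> real^'n \<Rightarrow> real^'n"
  where "gradient f x = (THE g. GDERIV f x :> g)"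

definition dual_ext :: "(real^'n \<Rightarrow> real) \<Rightarrow> dual^'n \<Rightarrow> dual"
  where "dual_ext f X =
    (let x = (\<chi> i. dre (X $ i)); w = (\<chi> i. deps (X $ i))
     in Dual (f x) (gradient f x \<bullet> w))"

definition dual_ext_min :: "nat \<Rightarrow> (nat \<Rightarrow> real^'n \<Rightarrow> real) \<Rightarrow> dual^'n \<Rightarrow> dual"
  where "dual_ext_min p hs X =
    foldl min_re (dual_ext (hs 1) X) (map (\<lambda>i. dual_ext (hs i) X) [2..<Suc p])"

text \<open>Instruction number \<open>j\<close> (from 0) writes register \<open>j\<close>. Inputs and literals are operands, so
  every instruction is exactly one addition, multiplication or comparison.\<close>

datatype 'n arg = Input 'n | Const real | Reg nat

datatype 'n instr =
    AddI "'n arg" "'n arg"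
  | MulI "'n arg" "'n arg"
  | MinI "'n arg" "'n arg"

datatype 'n slp = SLP (code: "'n instr list") (result: "'n arg")

fun arg_below :: "nat \<Rightarrow> 'n arg \<Rightarrow> bool" where
  "arg_below j (Reg k) = (k < j)"
| "arg_below j _ = True"

fun instr_below :: "nat \<Rightarrow> 'n instr \<Rightarrow> bool" where
  "instr_below j (AddI a b) = (arg_below j a \<and> arg_below j b)"
| "instr_below j (MulI a b) = (arg_below j a \<and> arg_below j b)"
| "instr_below j (MinI a b) = (arg_below j a \<and> arg_below j b)"

definition slp_wf :: "'n slp \<Rightarrow> bool"
  where "slp_wf P \<longleftrightarrow>
    (\<forall>j < length (code P). instr_below j (code P ! j)) \<and>
    arg_below (length (code P)) (result P)"

definition slp_ops :: "'n slp \<Rightarrow> nat"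
  where "slp_ops P = length (code P)"

text \<open>One interpreter serves both carriers: \<open>lit\<close> embeds the literals and \<open>mn\<close> interprets the
  comparison; addition and multiplication are those of the carrier.\<close>

fun arg_val :: "(real \<Rightarrow> 'a) \<Rightarrow> 'a^'n \<Rightarrow> (nat \<Rightarrow> 'a) \<Rightarrow> 'n arg \<Rightarrow> 'a" where
  "arg_val lit x r (Input i) = x $ i"
| "arg_val lit x r (Const c) = lit c"
| "arg_val lit x r (Reg k) = r k"

fun instr_val ::
  "(real \<Rightarrow> 'a) \<Rightarrow> ('a \<Rightarrow> 'a \<Rightarrow> 'a) \<Rightarrow> 'a^'n \<Rightarrow> (nat \<Rightarrow> 'a) \<Rightarrow> 'n instr \<Rightarrow> 'a::{plus,times}" where
  "instr_val lit mn x r (AddI a b) = arg_val lit x r a + arg_val lit x r b"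
| "instr_val lit mn x r (MulI a b) = arg_val lit x r a * arg_val lit x r b"
| "instr_val lit mn x r (MinI a b) = mn (arg_val lit x r a) (arg_val lit x r b)"

definition registers ::
  "(real \<Rightarrow> 'a) \<Rightarrow> ('a \<Rightarrow> 'a \<Rightarrow> 'a) \<Rightarrow> 'a^'n \<Rightarrow> 'n instr list \<Rightarrow> 'a::{plus,times} list" where
  "registers lit mn x ins = foldl (\<lambda>vs i. vs @ [instr_val lit mn x ((!) vs) i]) [] ins"

definition eval_real_arg :: "'n slp \<Rightarrow> real^'n \<Rightarrow> 'n arg \<Rightarrow> real"
  where "eval_real_arg P x = arg_val (\<lambda>c. c) x ((!) (registers (\<lambda>c. c) min x (code P)))"

definition eval_real :: "'n slp \<Rightarrow> real^'n \<Rightarrow> real"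
  where "eval_real P x = eval_real_arg P x (result P)"

definition eval_dual :: "'n slp \<Rightarrow> dual^'n \<Rightarrow> dual"
  where "eval_dual P X =
    arg_val (\<lambda>c. Dual c 0) X ((!) (registers (\<lambda>c. Dual c 0) min_re X (code P))) (result P)"

text \<open>A register is \<open>min_free\<close> if no comparison enters its computation.\<close>

inductive min_free :: "'n instr list \<Rightarrow> 'n arg \<Rightarrow> bool" for ins where
  "min_free ins (Input i)"
| "min_free ins (Const c)"
| "\<lbrakk>k < length ins; ins ! k = AddI a b; min_free ins a; min_free ins b\<rbrakk> \<Longrightarrow> min_free ins (Reg k)"
| "\<lbrakk>k < length ins; ins ! k = MulI a b; min_free ins a; min_free ins b\<rbrakk> \<Longrightarrow> min_free ins (Reg k)"

text \<open>\<open>ordered_min ins a cs\<close>: operand \<open>a\<close> is obtained from the min-free operands \<open>cs\<close> by minima taken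
  from left to right, in any bracketing.\<close>

inductive ordered_min :: "'n instr list \<Rightarrow> 'n arg \<Rightarrow> 'n arg list \<Rightarrow> bool" for ins where
  "min_free ins a \<Longrightarrow> ordered_min ins a [a]"
| "\<lbrakk>k < length ins; ins ! k = MinI a b; ordered_min ins a cs; ordered_min ins b ds\<rbrakk>
    \<Longrightarrow> ordered_min ins (Reg k) (cs @ ds)"

text \<open>The program computes the components \<open>hs 1, \<dots>, hs p\<close> arithmetically and takes their minimum in
  this order. Merely computing the minimum as a real function does not determine the result over
  the dual numbers: \<open>min x 0 + (-1) * min ((-1) * x) 0\<close> evaluates \<open>x\<close> over the reals, but yields
  infinitesimal part 2 at \<open>0 + \<epsilon>\<close>.\<close>

definition componentwise ::
  "'n slp \<Rightarrow> (real^'n) set \<Rightarrow> nat \<Rightarrow> (nat \<Rightarrow> real^'n \<Rightarrow> real) \<Rightarrow> bool"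
  where "componentwise P D p hs \<longleftrightarrow>
    (\<exists>cs. length cs = p \<and> ordered_min (code P) (result P) cs \<and>
       (\<forall>i\<in>{1..p}. \<forall>x\<in>D. eval_real_arg P x (cs ! (i - 1)) = hs i x))"

text \<open>The memory of the real machine consists of two-field records, one scalar scratch cell and the
  outcome of the last comparison. Each machine operation is one real addition, multiplication,
  comparison, or conditional copy of a record.\<close>

datatype 'n src = ReOf "'n arg" | EpsOf "'n arg" | Scratch

datatype dst = ToRe nat | ToEps nat | ToScratch

datatype 'n real_op =
    RAdd dst "'n src" "'n src"
  | RMul dst "'n src" "'n src"
  | RLeq "'n src" "'n src"
  | RCopy nat "'n arg" "'n arg"

datatype state = State (recs: "nat \<Rightarrow> dual") (scratch: real) (flag: bool)

abbreviation rec_val :: "dual^'n \<Rightarrow> state \<Rightarrow> 'n arg \<Rightarrow> dual"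
  where "rec_val X s \<equiv> arg_val (\<lambda>c. Dual c 0) X (recs s)"

fun fetch :: "dual^'n \<Rightarrow> state \<Rightarrow> 'n src \<Rightarrow> real" where
  "fetch X s (ReOf a) = dre (rec_val X s a)"
| "fetch X s (EpsOf a) = deps (rec_val X s a)"
| "fetch X s Scratch = scratch s"

fun store :: "dst \<Rightarrow> real \<Rightarrow> state \<Rightarrow> state" where
  "store (ToRe j) c (State r t f) = State (r(j := Dual c (deps (r j)))) t f"
| "store (ToEps j) c (State r t f) = State (r(j := Dual (dre (r j)) c)) t f"
| "store ToScratch c (State r t f) = State r c f"

fun step :: "dual^'n \<Rightarrow> state \<Rightarrow> 'n real_op \<Rightarrow> state" where
  "step X s (RAdd d a b) = store d (fetch X s a + fetch X s b) s"
| "step X s (RMul d a b) = store d (fetch X s a * fetch X s b) s"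
| "step X s (RLeq a b) = State (recs s) (scratch s) (fetch X s a \<le> fetch X s b)"
| "step X s (RCopy j a b) =
    State ((recs s)(j := (if flag s then rec_val X s a else rec_val X s b))) (scratch s) (flag s)"

fun dual_instr :: "nat \<Rightarrow> 'n instr \<Rightarrow> 'n real_op list" where
  "dual_instr j (AddI a b) =
    [RAdd (ToRe j) (ReOf a) (ReOf b),
     RAdd (ToEps j) (EpsOf a) (EpsOf b)]"
| "dual_instr j (MulI a b) =
    [RMul (ToRe j) (ReOf a) (ReOf b),
     RMul ToScratch (ReOf a) (EpsOf b),
     RMul (ToEps j) (ReOf b) (EpsOf a),
     RAdd (ToEps j) Scratch (EpsOf (Reg j))]"
| "dual_instr j (MinI a b) =
    [RLeq (ReOf a) (ReOf b),
     RCopy j a b]"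

definition dual_code :: "'n slp \<Rightarrow> 'n real_op list"
  where "dual_code P = concat (map (\<lambda>j. dual_instr j (code P ! j)) [0..<length (code P)])"

definition run_dual_code :: "'n slp \<Rightarrow> dual^'n \<Rightarrow> dual"
  where "run_dual_code P X =
    rec_val X (foldl (step X) (State (\<lambda>_. 0) 0 False) (dual_code P)) (result P)"

definition dual_ops :: "'n slp \<Rightarrow> nat"
  where "dual_ops P = length (dual_code P)"

end

theory Submission
  imports Defs
begin

text \<open>Each instruction expands into at most four machine operations, and since its operands lie in
  earlier registers it sends the records to their updated dual values.  A min-free operand computes
  a polynomial, whose dual value is its first-order Taylor datum along the direction of the lift;
  agreement with \<open>hs i\<close> on the open set \<open>D\<close> forces equal gradients there.  Finally, the
  operation \<open>min_re\<close> picks the leftmost operand with minimal real part, so it is associative and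
  the bracketing of the minima is irrelevant.\<close>

section \<open>Counting machine operations\<close>

lemma dual_ops_le: "dual_ops P \<le> 4 * slp_ops P"
proof -
  have "length (dual_instr j i) \<le> 4" for j and i :: "'a instr"
    by (cases i) auto
  then have "sum_list (map (\<lambda>j. length (dual_instr j (code P ! j))) [0..<length (code P)])
      \<le> sum_list (map (\<lambda>j. 4) [0..<length (code P)])"
    by (intro sum_list_mono)
  then show ?thesis
    by (simp add: dual_ops_def slp_ops_def dual_code_def length_concat o_def sum_list_triv)
qed

section \<open>Correctness of the machine code\<close>

lemma arg_val_cong:
  "\<lbrakk>arg_below j a; \<And>k. k < j \<Longrightarrow> r k = r' k\<rbrakk> \<Longrightarrow> arg_val lit x r a = arg_val lit x r' a"
  by (cases a) auto

lemma instr_val_cong: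
  assumes "instr_below j i" "\<And>k. k < j \<Longrightarrow> r k = r' k"
  shows "instr_val lit mn x r i = instr_val lit mn x r' i"
  using assms by (cases i) (auto simp: arg_val_cong[of j _ r r'])

lemma registers_snoc:
  "registers lit mn x (ins @ [i]) =
     registers lit mn x ins @ [instr_val lit mn x ((!) (registers lit mn x ins)) i]"
  by (simp add: registers_def)

lemma length_registers [simp]: "length (registers lit mn x ins) = length ins"
  by (induction ins rule: rev_induct) (simp_all add: registers_snoc, simp add: registers_def)

text \<open>Registers are computed from the prefix of values available so far. Since operands point
  backwards, the finished list satisfies the same equations, so later proofs need not track
  prefixes.\<close>

lemma registers_nth:
  assumes "\<And>j. j < length ins \<Longrightarrow> instr_below j (ins ! j)" "k < length ins"
  shows "registers lit mn x ins ! k = instr_val lit mn x ((!) (registers lit mn x ins)) (ins ! k)"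
  using assms
proof (induction ins arbitrary: k rule: rev_induct)
  case Nil
  then show ?case by simp
next
  case (snoc i ins)
  have below: "instr_below j (ins ! j)" if "j < length ins" for j
    using snoc.prems(1)[of j] that by (simp add: nth_append)
  \<comment> \<open>Instruction \<open>k\<close> reads only registers below \<open>k\<close>, and
    \<open>k \<le> length ins\<close>, so the appended value is never read.\<close>
  have cong: "instr_val lit mn x ((!) (registers lit mn x ins)) ((ins @ [i]) ! k) =
      instr_val lit mn x ((!) (registers lit mn x (ins @ [i]))) ((ins @ [i]) ! k)"
    by (rule instr_val_cong[OF snoc.prems(1)[OF snoc.prems(2)]])
      (use snoc.prems(2) in \<open>simp add: registers_snoc nth_append\<close>)
  show ?case
  proof (cases "k < length ins")
    case True
    then have "registers lit mn x (ins @ [i]) ! k = registers lit mn x ins ! k"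
      by (simp add: registers_snoc nth_append)
    also have "\<dots> = instr_val lit mn x ((!) (registers lit mn x ins)) ((ins @ [i]) ! k)"
      using snoc.IH[OF below True] True by (simp add: nth_append)
    finally show ?thesis using cong by simp
  next
    case False
    then have "k = length ins"
      using snoc.prems(2) by simp
    then have "registers lit mn x (ins @ [i]) ! k =
        instr_val lit mn x ((!) (registers lit mn x ins)) ((ins @ [i]) ! k)"
      by (simp add: registers_snoc nth_append)
    then show ?thesis using cong by simp
  qed
qed

lemma arg_val_upd:
  "arg_below j a \<Longrightarrow> arg_val lit x (r(j := z)) a = arg_val lit x r a"
  by (rule arg_val_cong) auto

text \<open>Additions and multiplications overwrite fields of record \<open>j\<close> while operands
  are still being read. This is safe because operands lie below \<open>j\<close>. A multiplication
  holds one cross product in the scratch cell and the other in the infinitesimal field of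
  \<open>j\<close> before summing them. Scratch cell and flag are always written before being read,
  so only the records matter.\<close>

lemma recs_dual_instr:
  assumes "instr_below j i"
  shows "recs (foldl (step X) s (dual_instr j i)) =
    (recs s)(j := instr_val (\<lambda>c. Dual c 0) min_re X (recs s) i)"
  using assms
  by (cases s; cases i)
    (auto simp: arg_val_upd plus_dual_def times_dual_def min_re_def)

text \<open>Invariant after \<open>m\<close> instructions: records below \<open>m\<close> are final.
  The initial state \<open>s\<close> is arbitrary because every record is written before it is
  read.\<close>

lemma recs_run:
  assumes "slp_wf P" "m \<le> length (code P)" "k < m"
  shows "recs (foldl (step X) s (concat (map (\<lambda>j. dual_instr j (code P ! j)) [0..<m]))) k =
    registers (\<lambda>c. Dual c 0) min_re X (code P) ! k"
  using assms(2,3)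
proof (induction m arbitrary: k)
  case 0
  then show ?case by simp
next
  case (Suc m)
  let ?R = "registers (\<lambda>c. Dual c 0) min_re X (code P)"
  let ?s = "foldl (step X) s (concat (map (\<lambda>j. dual_instr j (code P ! j)) [0..<m]))"
  have wf: "\<And>j. j < length (code P) \<Longrightarrow> instr_below j (code P ! j)"
    using assms(1) by (simp add: slp_wf_def)
  have below: "instr_below m (code P ! m)"
    using Suc.prems wf by simp
  have IH: "recs ?s l = ?R ! l" if "l < m" for l
    using Suc that by simp
  have "instr_val (\<lambda>c. Dual c 0) min_re X (recs ?s) (code P ! m) = ?R ! m"
    using instr_val_cong[OF below, of "recs ?s" "(!) ?R"] IH
      registers_nth[of "code P" m, OF wf, of "\<lambda>c. Dual c 0" min_re X] Suc.prems by simp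
  then show ?case
    using Suc.prems IH by (auto simp: recs_dual_instr[OF below] less_Suc_eq)
qed

lemma run_dual_code_eq_eval_dual:
  assumes "slp_wf P"
  shows "run_dual_code P X = eval_dual P X"
  unfolding run_dual_code_def eval_dual_def dual_code_def
  by (rule arg_val_cong[where j = "length (code P)"])
    (use assms recs_run[OF assms order_refl] in \<open>auto simp: slp_wf_def\<close>)

section \<open>Gradients of min-free operands\<close>

definition eval_dual_arg :: "'n slp \<Rightarrow> dual^'n \<Rightarrow> 'n arg \<Rightarrow> dual" where
  "eval_dual_arg P X =
     arg_val (\<lambda>c. Dual c 0) X ((!) (registers (\<lambda>c. Dual c 0) min_re X (code P)))"

lemma eval_dual_arg_simps [simp]:
  "eval_dual_arg P X (Input i) = X $ i"
  "eval_dual_arg P X (Const c) = Dual c 0"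
  by (simp_all add: eval_dual_arg_def)

lemma eval_real_arg_simps [simp]:
  "eval_real_arg P x (Input i) = x $ i"
  "eval_real_arg P x (Const c) = c"
  by (simp_all add: eval_real_arg_def)

lemma eval_dual_arg_Reg:
  assumes "slp_wf P" "k < length (code P)"
  shows "code P ! k = AddI a b \<Longrightarrow>
      eval_dual_arg P X (Reg k) = eval_dual_arg P X a + eval_dual_arg P X b"
    and "code P ! k = MulI a b \<Longrightarrow>
      eval_dual_arg P X (Reg k) = eval_dual_arg P X a * eval_dual_arg P X b"
    and "code P ! k = MinI a b \<Longrightarrow>
      eval_dual_arg P X (Reg k) = min_re (eval_dual_arg P X a) (eval_dual_arg P X b)"
  using assms registers_nth[of "code P" k "\<lambda>c. Dual c 0" min_re X]
  by (auto simp: eval_dual_arg_def slp_wf_def)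

lemma eval_real_arg_Reg:
  assumes "slp_wf P" "k < length (code P)"
  shows "code P ! k = AddI a b \<Longrightarrow>
      eval_real_arg P x (Reg k) = eval_real_arg P x a + eval_real_arg P x b"
    and "code P ! k = MulI a b \<Longrightarrow>
      eval_real_arg P x (Reg k) = eval_real_arg P x a * eval_real_arg P x b"
  using assms registers_nth[of "code P" k "\<lambda>c. c" min x]
  by (auto simp: eval_real_arg_def slp_wf_def)

lemma GDERIV_component: "GDERIV (\<lambda>x :: real^'n. x $ i) x :> axis i 1"
  unfolding gderiv_def
  by (simp add: inner_axis bounded_linear_vec_nth bounded_linear_imp_has_derivative)

text \<open>Justifies the definite description in \<open>gradient\<close>.\<close>

lemma GDERIV_unique:
  assumes "GDERIV f x :> g" "GDERIV f x :> g'"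
  shows "g = g'"
proof -
  have "(\<lambda>h. h \<bullet> g) = (\<lambda>h. h \<bullet> g')"
    using has_derivative_unique[OF assms[unfolded gderiv_def]] .
  then show ?thesis
    by (simp add: fun_eq_iff vector_eq_ldot)
qed

text \<open>The infinitesimal parts of dual sums and products are the sum and product rules applied
  to directional derivatives. Differentiability is proved in the same induction, since those rules
  need it for the operands. The point \<open>x\<close> is arbitrary because such operands are
  polynomials on the whole space.\<close>

lemma min_free_GDERIV:
  fixes P :: "'n::finite slp"
  assumes "slp_wf P" "min_free (code P) a"
  shows "\<exists>g. GDERIV (\<lambda>y. eval_real_arg P y a) x :> g \<and>
    eval_dual_arg P (dual_lift v x) a = Dual (eval_real_arg P x a) (g \<bullet> v x)"
  using assms(2)
proof induction
  case (1 i)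
  then show ?case
    using GDERIV_component by (auto simp: dual_lift_def inner_axis' intro!: exI[of _ "axis i 1"])
next
  case (2 c)
  then show ?case
    by (intro exI[of _ 0]) (simp add: GDERIV_const)
next
  case (3 k a b)
  then obtain ga gb where
    "GDERIV (\<lambda>y. eval_real_arg P y a) x :> ga" "GDERIV (\<lambda>y. eval_real_arg P y b) x :> gb" and
    "eval_dual_arg P (dual_lift v x) a = Dual (eval_real_arg P x a) (ga \<bullet> v x)"
    "eval_dual_arg P (dual_lift v x) b = Dual (eval_real_arg P x b) (gb \<bullet> v x)"
    by blast
  then show ?case
    using GDERIV_add[of "\<lambda>y. eval_real_arg P y a" x ga "\<lambda>y. eval_real_arg P y b" gb]
    by (intro exI[of _ "ga + gb"])
      (simp add: eval_dual_arg_Reg(1)[OF assms(1) 3(1,2)] eval_real_arg_Reg(1)[OF assms(1) 3(1,2)]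
        plus_dual_def inner_add_left)
next
  case (4 k a b)
  then obtain ga gb where
    "GDERIV (\<lambda>y. eval_real_arg P y a) x :> ga" "GDERIV (\<lambda>y. eval_real_arg P y b) x :> gb" and
    "eval_dual_arg P (dual_lift v x) a = Dual (eval_real_arg P x a) (ga \<bullet> v x)"
    "eval_dual_arg P (dual_lift v x) b = Dual (eval_real_arg P x b) (gb \<bullet> v x)"
    by blast
  then show ?case
    using GDERIV_mult[of "\<lambda>y. eval_real_arg P y a" x ga "\<lambda>y. eval_real_arg P y b" gb]
    by (intro exI[of _ "eval_real_arg P x a *\<^sub>R gb + eval_real_arg P x b *\<^sub>R ga"])
      (simp add: eval_dual_arg_Reg(2)[OF assms(1) 4(1,2)] eval_real_arg_Reg(2)[OF assms(1) 4(1,2)]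
        times_dual_def inner_add_left)
qed

lemma eval_dual_arg_eq_dual_ext:
  fixes P :: "'n::finite slp"
  assumes "slp_wf P" "min_free (code P) a" "open D" "x \<in> D"
    and eq: "\<And>y. y \<in> D \<Longrightarrow> eval_real_arg P y a = f y"
  shows "eval_dual_arg P (dual_lift v x) a = dual_ext f (dual_lift v x)"
proof -
  obtain g where g: "GDERIV (\<lambda>y. eval_real_arg P y a) x :> g"
    and val: "eval_dual_arg P (dual_lift v x) a = Dual (eval_real_arg P x a) (g \<bullet> v x)"
    using min_free_GDERIV[OF assms(1,2)] by blast
  have "GDERIV f x :> g"
    using has_derivative_transform_within_open[OF g[unfolded gderiv_def] assms(3,4) eq]
    by (simp add: gderiv_def)
  then have "gradient f x = g"
    unfolding gradient_def by (rule the_equality) (rule GDERIV_unique[OF _ \<open>GDERIV f x :> g\<close>])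
  then show ?thesis
    using val eq[OF assms(4)] by (simp add: dual_ext_def dual_lift_def)
qed

section \<open>Minima over the dual numbers\<close>

lemma foldl_min_re: "foldl min_re (min_re a b) zs = min_re a (foldl min_re b zs)"
proof (induction zs arbitrary: b)
  case (Cons c zs)
  \<comment> \<open>On ties both bracketings keep the leftmost operand.\<close>
  have "min_re (min_re a b) c = min_re a (min_re b c)"
    by (auto simp: min_re_def)
  with Cons show ?case by simp
qed simp

lemma ordered_min_min_free:
  "ordered_min ins a cs \<Longrightarrow> cs \<noteq> [] \<and> (\<forall>c\<in>set cs. min_free ins c)"
  by (induction rule: ordered_min.induct) auto

text \<open>The fold starts at the head because \<open>min_re\<close> has no neutral
  element.\<close>

lemma eval_dual_arg_ordered_min:
  fixes P :: "'n::finite slp"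
  assumes "slp_wf P" "ordered_min (code P) a cs"
  shows "eval_dual_arg P X a =
    foldl min_re (eval_dual_arg P X (hd cs)) (map (eval_dual_arg P X) (tl cs))"
  using assms(2)
proof induction
  case (2 k a b cs ds)
  \<comment> \<open>With both lists nonempty, the fold over \<open>cs @ ds\<close> reaches
    \<open>d\<close> with the minimum of \<open>cs\<close> as accumulator, and
    \<open>foldl_min_re\<close> splits it there.\<close>
  obtain c cs' d ds' where "cs = c # cs'" "ds = d # ds'"
    using 2(3,4)[THEN ordered_min_min_free] by (meson neq_Nil_conv)
  then show ?case
    using 2 eval_dual_arg_Reg(3)[OF assms(1) 2(1,2)] by (simp add: foldl_min_re)
qed simp

lemma eval_dual_eq_dual_ext_min:
  fixes P :: "'n::finite slp"
  assumes "slp_wf P" "open D" "x \<in> D" "componentwise P D p hs"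
  shows "eval_dual P (dual_lift v x) = dual_ext_min p hs (dual_lift v x)"
proof -
  let ?X = "dual_lift v x"
  obtain cs where cs: "length cs = p" "ordered_min (code P) (result P) cs"
    and hs: "\<And>i y. \<lbrakk>i \<in> {1..p}; y \<in> D\<rbrakk> \<Longrightarrow> eval_real_arg P y (cs ! (i - 1)) = hs i y"
    using assms(4) unfolding componentwise_def by blast
  note mf = ordered_min_min_free[OF cs(2)]
  have val: "eval_dual_arg P ?X (cs ! i) = dual_ext (hs (Suc i)) ?X" if "i < p" for i
    by (rule eval_dual_arg_eq_dual_ext[OF assms(1) _ assms(2,3)])
      (use that cs(1) mf hs[of "Suc i"] in auto)
  have "hd cs = cs ! 0" "p > 0"
    using mf cs(1) by (auto simp: hd_conv_nth)
  \<comment> \<open>Lists count from 0 and components from 1: entry \<open>i\<close> of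
    \<open>tl cs\<close> is \<open>cs ! Suc i\<close>, which computes
    \<open>hs (i + 2)\<close>.\<close>
  moreover have "map (eval_dual_arg P ?X) (tl cs) = map (\<lambda>i. dual_ext (hs i) ?X) [2..<Suc p]"
    using cs(1) by (intro nth_equalityI) (auto simp: nth_tl val numeral_2_eq_2 simp del: upt_Suc)
  ultimately show ?thesis
    using eval_dual_arg_ordered_min[OF assms(1) cs(2), of ?X] val[of 0]
    by (simp add: eval_dual_def eval_dual_arg_def[symmetric] dual_ext_min_def del: upt_Suc)
qed

theorem proposition3:
  fixes D :: "(real^'n) set"
    and p :: nat
    and hs :: "nat \<Rightarrow> real^'n \<Rightarrow> real"
    and h :: "real^'n \<Rightarrow> real"
    and P :: "'n slp"
  assumes "open D"
    and "p \<ge> 1"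
    and "\<And>i. i \<in> {1..p} \<Longrightarrow> hs i differentiable_on D"
    and "\<And>x. x \<in> D \<Longrightarrow> h x = Min ((\<lambda>i. hs i x) ` {1..p})"
    and "slp_wf P"
    and "\<And>x. x \<in> D \<Longrightarrow> eval_real P x = h x"
  shows "dual_ops P \<le> 4 * slp_ops P
    \<and> int (dual_ops P) - int (slp_ops P) \<le> 3 * int (slp_ops P)
    \<and> (\<forall>v. continuous_on D v \<longrightarrow> (\<forall>x\<in>D.
          run_dual_code P (dual_lift v x) = eval_dual P (dual_lift v x)
          \<and> (componentwise P D p hs \<longrightarrow>
               run_dual_code P (dual_lift v x) = dual_ext_min p hs (dual_lift v x))))"
  using dual_ops_le[of P] run_dual_code_eq_eval_dual[OF assms(5)]
    eval_dual_eq_dual_ext_min[OF assms(5,1)]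
  by auto

end
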